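(* Let $Q=[q_{0},q^{\top}]^{\top}\in\mathbb{S}^{3}$ be a unit-quaternion vector with $q_{0}\in\mathbb{R}$ and $q\in\mathbb{R}^{3}$, and let $R\in\mathbb{SO}(3)$ be the rotation matrix represented by $Q$, i.e. $R=(q_{0}^{2}-\Vert q\Vert^{2})\mathbf{I}_{3}+2qq^{\top}+2q_{0}[q]_{\times}$. Then $$\mathbf{vex}\left(\boldsymbol{\mathcal{P}}_{a}(R)\right)=2q_{0}q,$$ $$\left\Vert R\right\Vert_{I}=1-q_{0}^{2},$$ $$\left\Vert \mathbf{vex}\left(\boldsymbol{\mathcal{P}}_{a}(R)\right)\right\Vert^{2}=4q_{0}^{2}\Vert q\Vert^{2}.$$
   Context: $\mathbb{SO}(3)=\{R\in\mathbb{R}^{3\times3}: R^{\top}R=RR^{\top}=\mathbf{I}_{3},\ \det(R)=+1\}$ and $\mathbb{S}^{3}=\{Q\in\mathbb{R}^{4}:\Vert Q\Vert=1\}$, where $\Vert\cdot\Vert$ is the Euclidean norm on vectors. For $x=[x_1,x_2,x_3]^{\top}\in\mathbb{R}^{3}$, $[x]_{\times}=\begin{bmatrix} 0 & -x_3 & x_2 \\ x_3 & 0 & -x_1 \\ -x_2 & x_1 & 0 \end{bmatrix}$, so $[x]_{\times} y=x\times y$. The map $\mathbf{vex}$ from $3\times3$ skew-symmetric matrices to $\mathbb{R}^{3}$ is the inverse of $[\cdot]_{\times}$, i.e. $\mathbf{vex}([x]_{\times})=x$. For $B\in\mathbb{R}^{3\times3}$, $\boldsymbol{\mathcal{P}}_{a}(B)=\frac{1}{2}(B-B^{\top})$.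 For $R\in\mathbb{SO}(3)$ the normalized Euclidean distance is $\Vert R\Vert_{I}=\frac{1}{4}\mathrm{Tr}\{\mathbf{I}_{3}-R\}$. *)

theory Defs
  imports "HOL-Analysis.Analysis"
begin

definition cross_mat :: "real^3 \<Rightarrow> real^3^3" where
  "cross_mat x = vector [vector [0, - (x $ 3), x $ 2],
                         vector [x $ 3, 0, - (x $ 1)],
                         vector [- (x $ 2), x $ 1, 0]]"

definition skew_symmetric :: "real^3^3 \<Rightarrow> bool" where
  "skew_symmetric A \<longleftrightarrow> transpose A = - A"

text \<open>Only meaningful on skew-symmetric matrices, which are exactly the range of the
  injective map \<open>cross_mat\<close> (lemmas \<open>inj_cross_mat\<close> and \<open>range_cross_mat\<close>).\<close>

definition vex :: "real^3^3 \<Rightarrow> real^3" where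
  "vex = inv cross_mat"

definition proj_anti :: "real^3^3 \<Rightarrow> real^3^3" where
  "proj_anti B = (1 / 2) *\<^sub>R (B - transpose B)"

definition dist_I :: "real^3^3 \<Rightarrow> real" where
  "dist_I R = (1 / 4) * trace (mat 1 - R)"

text \<open>The constraint \<open>real^3^1\<close> makes \<open>q q\<^sup>\<top>\<close> the product of a
  \<open>3 \<times> 1\<close> and a \<open>1 \<times> 3\<close> matrix; without it the inner dimension is a free type
  variable.\<close>

definition quat_rotation :: "real \<Rightarrow> real^3 \<Rightarrow> real^3^3" where
  "quat_rotation q0 q =
     (q0\<^sup>2 - (norm q)\<^sup>2) *\<^sub>R mat 1
     + 2 *\<^sub>R (columnvector q ** (rowvector q :: real^3^1))
     + (2 * q0) *\<^sub>R cross_mat q"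

lemma cross_mat_mult: "cross_mat x *v y = cross3 x y"
  by (simp add: cross_mat_def cross3_def vec_eq_iff forall_3 matrix_vector_mult_def sum_3)

lemma inj_cross_mat: "inj cross_mat"
  by (rule injI) (simp add: cross_mat_def vec_eq_iff forall_3)

lemma range_cross_mat: "range cross_mat = {A. skew_symmetric A}"
proof (intro equalityI subsetI)
  fix A assume "A \<in> range cross_mat"
  then show "A \<in> {A. skew_symmetric A}"
    by (auto simp: skew_symmetric_def cross_mat_def transpose_def vec_eq_iff forall_3)
next
  fix A assume "A \<in> {A. skew_symmetric A}"
  then have t: "transpose A = - A"
    by (simp add: skew_symmetric_def)
  have e: "A $ j $ i = - (A $ i $ j)" for i j
  proof -
    have "transpose A $ i $ j = A $ j $ i"
      by (simp add: transpose_def)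
    then show ?thesis
      unfolding t by simp
  qed
  have z: "A $ i $ i = 0" for i
    using e[of i i] by simp
  have "A = cross_mat (vector [A $ 3 $ 2, A $ 1 $ 3, A $ 2 $ 1])"
    using e[of 3 2] e[of 1 3] e[of 2 1] by (simp add: cross_mat_def vec_eq_iff forall_3 z)
  then show "A \<in> range cross_mat" by blast
qed

lemma vex_cross_mat: "vex (cross_mat x) = x"
  by (simp add: vex_def inj_cross_mat)

lemma cross_mat_vex: "skew_symmetric A \<Longrightarrow> cross_mat (vex A) = A"
  unfolding vex_def by (rule f_inv_into_f) (simp add: range_cross_mat)

lemma skew_symmetric_proj_anti: "skew_symmetric (proj_anti B)"
proof -
  have "transpose (proj_anti B) $ i $ j = (- proj_anti B) $ i $ j" for i j
    by (simp add: proj_anti_def transpose_def right_diff_distrib)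
  then show ?thesis
    by (simp only: skew_symmetric_def vec_eq_iff) blast
qed

lemma rotation_matrix_quat_rotation:
  assumes "q0\<^sup>2 + (norm q)\<^sup>2 = 1"
  shows "rotation_matrix (quat_rotation q0 q)"
proof -
  obtain a b c d where q: "q0 = a" "q $ 1 = b" "q $ 2 = c" "q $ 3 = d" by simp
  have n: "(norm q)\<^sup>2 = b * b + c * c + d * d"
    unfolding power2_norm_eq_inner inner_vec_def sum_3 q[symmetric] by simp
  have u: "a * a + b * b + c * c + d * d = 1"
    using assms unfolding n q by (simp add: power2_eq_square)
  define A :: "real^3^3" where
    "A = vector [vector [a*a+b*b-c*c-d*d, 2*(b*c-a*d), 2*(b*d+a*c)],
                 vector [2*(b*c+a*d), a*a-b*b+c*c-d*d, 2*(c*d-a*b)],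
                 vector [2*(b*d-a*c), 2*(c*d+a*b), a*a-b*b-c*c+d*d]]"
  have R: "quat_rotation q0 q = A"
    unfolding quat_rotation_def n A_def
    by (simp add: vec_eq_iff forall_3 matrix_matrix_mult_def mat_def q sum_1
        cross_mat_def columnvector_def rowvector_def power2_eq_square algebra_simps)
  have "transpose A ** A = ((a*a+b*b+c*c+d*d)*(a*a+b*b+c*c+d*d)) *\<^sub>R mat 1"
    unfolding A_def
    by (simp add: vec_eq_iff forall_3 matrix_matrix_mult_def transpose_def mat_def sum_3
        algebra_simps)
  moreover have "det A = (a*a+b*b+c*c+d*d)*((a*a+b*b+c*c+d*d)*(a*a+b*b+c*c+d*d))"
    unfolding A_def by (simp add: det_3 algebra_simps)
  ultimately show ?thesis
    by (simp add: rotation_matrix_def orthogonal_matrix R u)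
qed

lemma norm_quaternion:
  "(norm (vector [q0, q $ 1, q $ 2, q $ 3] :: real^4))\<^sup>2 = q0\<^sup>2 + (norm q)\<^sup>2" for q :: "real^3"
proof -
  let ?v = "vector [q0, q $ 1, q $ 2, q $ 3] :: real^4"
  have "?v $ 1 = q0" "?v $ 2 = q $ 1" "?v $ 3 = q $ 2" "?v $ 4 = q $ 3"
    unfolding vector_def by simp_all
  then show ?thesis
    unfolding power2_norm_eq_inner inner_vec_def sum_3 sum_4 by (simp add: power2_eq_square)
qed

end

theory Submission
  imports Defs
begin

text \<open>The identity and \<open>q q^T\<close> parts of the rotation matrix are symmetric, so
  antisymmetrization leaves exactly its cross-product part (\<open>proj_anti_quat_rotation\<close>),
  which \<open>vex\<close> inverts; taking norms gives the third identity. The distance depends only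
  on the trace (\<open>trace_quat_rotation\<close>), evaluated on the unit sphere.\<close>

lemma proj_anti_quat_rotation: "proj_anti (quat_rotation q0 q) = cross_mat ((2 * q0) *\<^sub>R q)"
  by (simp add: proj_anti_def quat_rotation_def transpose_def vec_eq_iff forall_3 sum_1
      matrix_matrix_mult_def mat_def cross_mat_def columnvector_def rowvector_def algebra_simps)

text \<open>The cross-product part is traceless and \<open>q q^T\<close> has trace
  \<open>|q|^2\<close>, so the total is \<open>3 (q0^2 - |q|^2) + 2 |q|^2\<close>.\<close>

lemma trace_quat_rotation: "trace (quat_rotation q0 q) = 3 * q0\<^sup>2 - (norm q)\<^sup>2"
proof -
  have "(norm q)\<^sup>2 = (q $ 1)\<^sup>2 + (q $ 2)\<^sup>2 + (q $ 3)\<^sup>2"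
    unfolding power2_norm_eq_inner inner_vec_def sum_3 by (simp add: power2_eq_square)
  then show ?thesis
    by (simp add: trace_def quat_rotation_def sum_3 sum_1 matrix_matrix_mult_def mat_def
        cross_mat_def columnvector_def rowvector_def power2_eq_square algebra_simps)
qed

theorem lemma5:
  fixes Q :: "real^4" and q0 :: real and q :: "real^3" and R :: "real^3^3"
  assumes "Q = vector [q0, q $ 1, q $ 2, q $ 3]"
    and "Q \<in> sphere 0 1"
    and "rotation_matrix R"
    and "R = quat_rotation q0 q"
  shows "vex (proj_anti R) = (2 * q0) *\<^sub>R q
    \<and> dist_I R = 1 - q0\<^sup>2
    \<and> (norm (vex (proj_anti R)))\<^sup>2 = 4 * q0\<^sup>2 * (norm q)\<^sup>2"
proof (intro conjI)
  have unit: "q0\<^sup>2 + (norm q)\<^sup>2 = 1"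
    using assms(1,2) norm_quaternion[of q0 q] by simp
  show vex: "vex (proj_anti R) = (2 * q0) *\<^sub>R q"
    by (simp add: assms(4) proj_anti_quat_rotation vex_cross_mat)
  \<comment> \<open>By \<open>unit\<close> the trace equals \<open>4 q0^2 - 1\<close>, so a quarter
    of 3 minus the trace is \<open>1 - q0^2\<close>.\<close>
  show "dist_I R = 1 - q0\<^sup>2"
    using unit by (simp add: dist_I_def assms(4) trace_sub trace_I trace_quat_rotation)
  show "(norm (vex (proj_anti R)))\<^sup>2 = 4 * q0\<^sup>2 * (norm q)\<^sup>2"
    by (simp add: vex power_mult_distrib)
qed

end
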